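(* The logic $\mathrm{SHML}_{\mathrm{nf}}$ is enforceable: for every closed formula $\varphi \in \mathrm{SHML}_{\mathrm{nf}}$ there exists a transducer $e$ that enforces $\varphi$, i.e. (i) for every system state $p$, if $\varphi$ is satisfiable then $e[p] \in [\![\varphi]\!]$, and (ii) for every system state $p$, if $p \in [\![\varphi]\!]$ then $e[p] \sim p$ (strong bisimilarity).
   Context: Systems: an LTS $\langle \mathrm{Sys}, \mathrm{Act}\cup\{\tau\}, \to\rangle$ with states $p,q\in\mathrm{Sys}$, observable actions $\alpha\in\mathrm{Act}$ and silent action $\tau\notin\mathrm{Act}$; $\mu$ ranges over $\mathrm{Act}\cup\{\tau\}$. $p \Rightarrow^{\alpha} q$ means $p (\to^{\tau})^* \to^{\alpha} (\to^{\tau})^* q$; for a trace $s=\alpha_1\cdots\alpha_n$, $p\Rightarrow^{s} q$ is a sequence of such weak transitions ($p\Rightarrow^{\varepsilon}q$ means $p(\to^\tau)^*q$). $\sim$ is strong bisimilarity on the LTS of all system and monitored-system states. Symbolic actions: patterns $\pi$ over actions may contain data variables, free ($x$) or binding ($(x)$); a closed pattern has no free variables. A partial matching function $\mathrm{mtch}(\pi,\alpha)$ returns a substitution $\sigma$ such that instantiating each bound variable $x$ of $\pi$ with $\sigma(x)$ yields $\alpha$. A condition $c$ is a boolean expression over the bound variables of $\pi$; $c\sigma \Downarrow \mathrm{true}$ means it evaluates to true under $\sigma$. A closed symbolic action $\{\pi,c\}$ denotes $[\![\{\pi,c\}]\!]=\{\alpha \mid \exists\sigma.\ \mathrm{mtch}(\pi,\alpha)=\sigma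 \text{ and } c\sigma\Downarrow\mathrm{true}\}$. $\underline{\pi}$ denotes $\pi$ with every binding occurrence $(x)$ replaced by the free occurrence $x$ (so $\underline{\pi}\sigma=\alpha$ when $\mathrm{mtch}(\pi,\alpha)=\sigma$). SHML: $\varphi ::= \mathrm{tt} \mid \mathrm{ff} \mid \bigwedge_{i\in I}\varphi_i \mid [\{\pi,c\}]\varphi \mid X \mid \max X.\varphi$ ($I$ finite; binders of $\pi$ bind in $c$ and $\varphi$). Semantics w.r.t. valuation $\rho$ from logical variables to sets of states: $[\![\mathrm{tt}]\!]=\mathrm{Sys}$, $[\![\mathrm{ff}]\!]=\emptyset$, $[\![X]\!]=\rho(X)$, $[\![\bigwedge_i\varphi_i]\!]=\bigcap_i[\![\varphi_i]\!]$, $[\![[\{\pi,c\}]\varphi]\!]=\{p \mid \forall \alpha,q.\ (p\Rightarrow^\alpha q \text{ and } \exists\sigma.\ \mathrm{mtch}(\pi,\alpha)=\sigma,\ c\sigma\Downarrow\mathrm{true}) \text{ implies } q\in[\![\varphi\sigma]\!]\}$, $[\![\max X.\varphi]\!]=\bigcup\{S\mid S\subseteq[\![\varphi,\rho[X\mapsto S]]\!]\}$. For closed $\varphi$ write $[\![\varphi]\!]$. $\varphi$ is satisfiable if $[\![\varphi]\!]\neq\emptyset$. $\mathrm{SHML}_{\mathrm{nf}}$ (normal form): $\varphi ::= \mathrm{tt}\mid\mathrm{ff}\mid \bigwedge_{i\in I}[\{\pi_i,c_i\}]\varphi_i \mid X \mid \max X.\varphi$, subject to: (1) in every $\bigwedge_{i\in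 I}[\{\pi_i,c_i\}]\varphi_i$, $[\![\{\pi_j,c_j\}]\!]\cap[\![\{\pi_h,c_h\}]\!]=\emptyset$ for $j\neq h$; (2) in every $\max X.\varphi$, $X$ is free in $\varphi$. Transducers: $e ::= \mathrm{id} \mid \{\pi,c,\pi'\}.e \mid \sum_{i\in I}e_i \mid \mathrm{rec}\,x.e \mid x$, where $\pi$ is a closed pattern (or the special symbol $\bullet$), $\pi'$ is a pattern or $\tau$, and free variables of $c,\pi',e$ are bound by $\pi$. Transitions $e\xrightarrow{\gamma\triangleright\mu}e'$ with $\gamma\in\mathrm{Act}\cup\{\bullet\}$: $\mathrm{id}\xrightarrow{\mu\triangleright\mu}\mathrm{id}$; $\{\pi,c,\pi'\}.e\xrightarrow{\gamma\triangleright\mu}e\sigma$ if $\mathrm{mtch}(\pi,\gamma)=\sigma$, $c\sigma\Downarrow\mathrm{true}$ and $\mu=\pi'\sigma$; $\sum_{i}e_i\xrightarrow{\gamma\triangleright\mu}e'$ if $e_j\xrightarrow{\gamma\triangleright\mu}e'$ for some $j$; $\mathrm{rec}\,x.e\xrightarrow{\gamma\triangleright\mu}e'$ if $e[\mathrm{rec}\,x.e/x]\xrightarrow{\gamma\triangleright\mu}e'$. Monitored system $e[p]$: (iTrn) if $p\xrightarrow{\alpha}p'$ and $e\xrightarrow{\alpha\triangleright\mu}e'$ then $e[p]\xrightarrow{\mu}e'[p']$; (iAsy) if $p\xrightarrow{\tau}p'$ then $e[p]\xrightarrow{\tau}e[p']$; (iIns) if $e\xrightarrow{\bullet\triangleright\mu}e'$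 then $e[p]\xrightarrow{\mu}e'[p]$; (iTer) if $p\xrightarrow{\alpha}p'$, $e$ has no transition labelled $\alpha\triangleright\mu$ for any $\mu$ and none labelled $\bullet\triangleright\mu$, then $e[p]\xrightarrow{\alpha}\mathrm{id}[p']$. *)

theory Defs
  imports Main
begin

section \<open>Actions, patterns and conditions\<close>

text \<open>Data variables, logical variables and recursion variables are drawn from countably infinite
  supplies of names.\<close>

type_synonym dvar = nat
type_synonym lvar = nat
type_synonym rvar = nat

type_synonym 'v subst = "dvar \<rightharpoonup> 'v"

text \<open>An observable action consists of a shape \<open>k\<close> (of an arbitrary type) and the data values it
  carries; for instance the input \<open>i?v\<close> is \<open>Act k [i, v]\<close> for a shape \<open>k\<close> standing for input.
  Patterns have data variables, free or binding, at some of the value positions.\<close>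

datatype ('k, 'v) act = Act 'k "'v list"

datatype 'a lab = Obs 'a | Tau

datatype 'v parg = PVal 'v | PVar dvar | PBind dvar

datatype ('k, 'v) pat = Pat 'k "'v parg list"

primrec pat_bv :: "('k, 'v) pat \<Rightarrow> dvar set" where
  "pat_bv (Pat k as) = {x. PBind x \<in> set as}"

text \<open>A plain occurrence of \<open>x\<close> in a pattern that also contains the binder \<open>(x)\<close> refers to
  that binder.\<close>

primrec pat_fv :: "('k, 'v) pat \<Rightarrow> dvar set" where
  "pat_fv (Pat k as) = {x. PVar x \<in> set as} - {x. PBind x \<in> set as}"

primrec arg_subst :: "'v parg \<Rightarrow> 'v subst \<Rightarrow> 'v parg" where
  "arg_subst (PVal v) \<sigma> = PVal v"
| "arg_subst (PVar x) \<sigma> = (case \<sigma> x of None \<Rightarrow> PVar x | Some v \<Rightarrow> PVal v)"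
| "arg_subst (PBind x) \<sigma> = PBind x"

definition pat_subst :: "('k, 'v) pat \<Rightarrow> 'v subst \<Rightarrow> ('k, 'v) pat" where
  "pat_subst \<pi> \<sigma> =
     (case \<pi> of Pat k as \<Rightarrow> Pat k (map (\<lambda>a. arg_subst a (\<sigma> |` (- pat_bv \<pi>))) as))"

text \<open>The underlined pattern: every binder \<open>(x)\<close> becomes the free occurrence \<open>x\<close>.\<close>

primrec arg_unbind :: "'v parg \<Rightarrow> 'v parg" where
  "arg_unbind (PVal v) = PVal v"
| "arg_unbind (PVar x) = PVar x"
| "arg_unbind (PBind x) = PVar x"

primrec pat_unbind :: "('k, 'v) pat \<Rightarrow> ('k, 'v) pat" where
  "pat_unbind (Pat k as) = Pat k (map arg_unbind as)"

primrec act_pat :: "('k, 'v) act \<Rightarrow> ('k, 'v) pat" where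
  "act_pat (Act k vs) = Pat k (map PVal vs)"

definition matches :: "('k, 'v) pat \<Rightarrow> ('k, 'v) act \<Rightarrow> 'v subst \<Rightarrow> bool" where
  "matches \<pi> \<alpha> \<sigma> \<longleftrightarrow> dom \<sigma> = pat_bv \<pi> \<and> pat_subst (pat_unbind \<pi>) \<sigma> = act_pat \<alpha>"

definition mtch :: "('k, 'v) pat \<Rightarrow> ('k, 'v) act \<Rightarrow> 'v subst option" where
  "mtch \<pi> \<alpha> = (if \<exists>\<sigma>. matches \<pi> \<alpha> \<sigma> then Some (THE \<sigma>. matches \<pi> \<alpha> \<sigma>) else None)"

lemma matches_unique:
  assumes "matches \<pi> \<alpha> \<sigma>" and "matches \<pi> \<alpha> \<sigma>'"
  shows "\<sigma> = \<sigma>'"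
proof
  fix x
  obtain k as where \<pi>: "\<pi> = Pat k as" by (cases \<pi>)
  have bv: "pat_bv (pat_unbind \<pi>) = {}"
  proof -
    have "arg_unbind a \<noteq> PBind y" for a :: "'b parg" and y by (cases a) auto
    then show ?thesis using \<pi> by (auto simp: image_iff) metis
  qed
  have eq: "map (\<lambda>a. arg_subst (arg_unbind a) \<sigma>) as = map (\<lambda>a. arg_subst (arg_unbind a) \<sigma>') as"
  proof -
    have "pat_subst (pat_unbind \<pi>) \<tau> = Pat k (map (\<lambda>a. arg_subst (arg_unbind a) \<tau>) as)"
      for \<tau> :: "'b subst"
      unfolding pat_subst_def bv using \<pi> by (simp add: comp_def restrict_map_def)
    with assms show ?thesis by (metis matches_def pat.inject)
  qed
  show "\<sigma> x = \<sigma>' x"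
  proof (cases "x \<in> pat_bv \<pi>")
    case True
    then have "PBind x \<in> set as" using \<pi> by simp
    with eq have "arg_subst (PVar x) \<sigma> = arg_subst (PVar x) \<sigma>'"
      by (metis (no_types, lifting) arg_unbind.simps(3) map_eq_conv)
    moreover have "x \<in> dom \<sigma>" "x \<in> dom \<sigma>'" using True assms by (auto simp: matches_def)
    ultimately show ?thesis by auto
  next
    case False
    then have "x \<notin> dom \<sigma>" "x \<notin> dom \<sigma>'" using assms by (auto simp: matches_def)
    then show ?thesis by (simp add: domIff)
  qed
qed

lemma mtch_Some_iff: "mtch \<pi> \<alpha> = Some \<sigma> \<longleftrightarrow> matches \<pi> \<alpha> \<sigma>"
proof
  assume "mtch \<pi> \<alpha> = Some \<sigma>"
  then obtain \<sigma>' where "matches \<pi> \<alpha> \<sigma>'" and "\<sigma> = (THE \<sigma>. matches \<pi> \<alpha> \<sigma>)"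
    by (auto simp: mtch_def split: if_splits)
  then show "matches \<pi> \<alpha> \<sigma>" by (metis matches_unique the_equality)
next
  assume "matches \<pi> \<alpha> \<sigma>"
  then show "mtch \<pi> \<alpha> = Some \<sigma>"
    unfolding mtch_def using matches_unique by (metis the_equality)
qed

text \<open>Boolean expressions: the atoms are arbitrary predicates on values, applied to values and data
  variables. Evaluation \<open>c \<Down> b\<close> is only possible if \<open>c\<close> has no data variables left.\<close>

datatype 'v vterm = Val 'v | DVar dvar

datatype 'v cond =
    CTrue
  | CAtom "'v list \<Rightarrow> bool" "'v vterm list"
  | CNot "'v cond"
  | CAnd "'v cond" "'v cond"

primrec cond_fv :: "'v cond \<Rightarrow> dvar set" where
  "cond_fv CTrue = {}"
| "cond_fv (CAtom P ts) = {x. DVar x \<in> set ts}"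
| "cond_fv (CNot c) = cond_fv c"
| "cond_fv (CAnd c d) = cond_fv c \<union> cond_fv d"

primrec vterm_subst :: "'v vterm \<Rightarrow> 'v subst \<Rightarrow> 'v vterm" where
  "vterm_subst (Val v) \<sigma> = Val v"
| "vterm_subst (DVar x) \<sigma> = (case \<sigma> x of None \<Rightarrow> DVar x | Some v \<Rightarrow> Val v)"

primrec cond_subst :: "'v cond \<Rightarrow> 'v subst \<Rightarrow> 'v cond" where
  "cond_subst CTrue \<sigma> = CTrue"
| "cond_subst (CAtom P ts) \<sigma> = CAtom P (map (\<lambda>t. vterm_subst t \<sigma>) ts)"
| "cond_subst (CNot c) \<sigma> = CNot (cond_subst c \<sigma>)"
| "cond_subst (CAnd c d) \<sigma> = CAnd (cond_subst c \<sigma>) (cond_subst d \<sigma>)"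

inductive cond_eval :: "'v cond \<Rightarrow> bool \<Rightarrow> bool" (infix "\<Down>" 50) where
  "CTrue \<Down> True"
| "CAtom P (map Val vs) \<Down> P vs"
| "c \<Down> b \<Longrightarrow> CNot c \<Down> (\<not> b)"
| "c \<Down> a \<Longrightarrow> d \<Down> b \<Longrightarrow> CAnd c d \<Down> (a \<and> b)"

text \<open>The set of actions denoted by a closed symbolic action.\<close>

definition sym_den :: "('k, 'v) pat \<Rightarrow> 'v cond \<Rightarrow> ('k, 'v) act set" where
  "sym_den \<pi> c = {\<alpha>. \<exists>\<sigma>. mtch \<pi> \<alpha> = Some \<sigma> \<and> cond_subst c \<sigma> \<Down> True}"

text \<open>Below a necessity, a symbolic action may have free data variables bound further out.
  Disjointness is then required of all its instances. Instances that are not closed denote the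
  empty set, and closed symbolic actions are their own only instance.\<close>

definition sym_disjoint ::
  "('k, 'v) pat \<Rightarrow> 'v cond \<Rightarrow> ('k, 'v) pat \<Rightarrow> 'v cond \<Rightarrow> bool" where
  "sym_disjoint \<pi> c \<pi>' c' \<longleftrightarrow>
     (\<forall>\<sigma>. sym_den (pat_subst \<pi> \<sigma>) (cond_subst c (\<sigma> |` (- pat_bv \<pi>)))
        \<inter> sym_den (pat_subst \<pi>' \<sigma>) (cond_subst c' (\<sigma> |` (- pat_bv \<pi>'))) = {})"


section \<open>The logic\<close>

datatype ('k, 'v) shml =
    TT
  | FF
  | Conj "('k, 'v) shml list"
  | Nec "('k, 'v) pat" "'v cond" "('k, 'v) shml"
  | LVar lvar
  | MaxFix lvar "('k, 'v) shml"

primrec shml_subst :: "('k, 'v) shml \<Rightarrow> 'v subst \<Rightarrow> ('k, 'v) shml" where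
  "shml_subst TT = (\<lambda>\<sigma>. TT)"
| "shml_subst FF = (\<lambda>\<sigma>. FF)"
| "shml_subst (Conj \<phi>s) = (\<lambda>\<sigma>. Conj (map (\<lambda>f. f \<sigma>) (map shml_subst \<phi>s)))"
| "shml_subst (Nec \<pi> c \<phi>) =
     (\<lambda>\<sigma>. Nec (pat_subst \<pi> \<sigma>) (cond_subst c (\<sigma> |` (- pat_bv \<pi>)))
               (shml_subst \<phi> (\<sigma> |` (- pat_bv \<pi>))))"
| "shml_subst (LVar X) = (\<lambda>\<sigma>. LVar X)"
| "shml_subst (MaxFix X \<phi>) = (\<lambda>\<sigma>. MaxFix X (shml_subst \<phi> \<sigma>))"

primrec shml_lfv :: "('k, 'v) shml \<Rightarrow> lvar set" where
  "shml_lfv TT = {}"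
| "shml_lfv FF = {}"
| "shml_lfv (Conj \<phi>s) = \<Union> (set (map shml_lfv \<phi>s))"
| "shml_lfv (Nec \<pi> c \<phi>) = shml_lfv \<phi>"
| "shml_lfv (LVar X) = {X}"
| "shml_lfv (MaxFix X \<phi>) = shml_lfv \<phi> - {X}"

primrec shml_dfv :: "('k, 'v) shml \<Rightarrow> dvar set" where
  "shml_dfv TT = {}"
| "shml_dfv FF = {}"
| "shml_dfv (Conj \<phi>s) = \<Union> (set (map shml_dfv \<phi>s))"
| "shml_dfv (Nec \<pi> c \<phi>) = pat_fv \<pi> \<union> ((cond_fv c \<union> shml_dfv \<phi>) - pat_bv \<pi>)"
| "shml_dfv (LVar X) = {}"
| "shml_dfv (MaxFix X \<phi>) = shml_dfv \<phi>"

definition shml_closed :: "('k, 'v) shml \<Rightarrow> bool" where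
  "shml_closed \<phi> \<longleftrightarrow> shml_lfv \<phi> = {} \<and> shml_dfv \<phi> = {}"

text \<open>Normal forms; finite indexed families are lists, and indices are list positions.\<close>

inductive shml_nf :: "('k, 'v) shml \<Rightarrow> bool" where
  "shml_nf TT"
| "shml_nf FF"
| "(\<forall>i < length bs. shml_nf (snd (snd (bs ! i)))) \<Longrightarrow>
   (\<forall>j < length bs. \<forall>h < length bs. j \<noteq> h \<longrightarrow>
      sym_disjoint (fst (bs ! j)) (fst (snd (bs ! j))) (fst (bs ! h)) (fst (snd (bs ! h)))) \<Longrightarrow>
   shml_nf (Conj (map (\<lambda>(\<pi>, c, \<phi>). Nec \<pi> c \<phi>) bs))"
| "shml_nf (LVar X)"
| "shml_nf \<phi> \<Longrightarrow> X \<in> shml_lfv \<phi> \<Longrightarrow> shml_nf (MaxFix X \<phi>)"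


section \<open>Semantics over a labelled transition system\<close>

type_synonym ('s, 'a) lts = "'s \<Rightarrow> 'a lab \<Rightarrow> 's \<Rightarrow> bool"

definition weak :: "('s, 'a) lts \<Rightarrow> 's \<Rightarrow> 'a \<Rightarrow> 's \<Rightarrow> bool" where
  "weak T p \<alpha> q \<longleftrightarrow>
     (\<exists>p' q'. (\<lambda>r r'. T r Tau r')\<^sup>*\<^sup>* p p' \<and> T p' (Obs \<alpha>) q' \<and> (\<lambda>r r'. T r Tau r')\<^sup>*\<^sup>* q' q)"

primrec shml_depth :: "('k, 'v) shml \<Rightarrow> nat" where
  "shml_depth TT = 0"
| "shml_depth FF = 0"
| "shml_depth (Conj \<phi>s) = Suc (sum_list (map shml_depth \<phi>s))"
| "shml_depth (Nec \<pi> c \<phi>) = Suc (shml_depth \<phi>)"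
| "shml_depth (LVar X) = 0"
| "shml_depth (MaxFix X \<phi>) = Suc (shml_depth \<phi>)"

lemma shml_depth_subst [simp]: "shml_depth (shml_subst \<phi> \<sigma>) = shml_depth \<phi>"
  by (induction \<phi> arbitrary: \<sigma>) (auto simp: comp_def cong: map_cong)

function sem :: "('s, ('k, 'v) act) lts \<Rightarrow> ('k, 'v) shml \<Rightarrow> (lvar \<Rightarrow> 's set) \<Rightarrow> 's set" where
  "sem T TT \<rho> = UNIV"
| "sem T FF \<rho> = {}"
| "sem T (Conj \<phi>s) \<rho> = (\<Inter>\<phi>\<in>set \<phi>s. sem T \<phi> \<rho>)"
| "sem T (Nec \<pi> c \<phi>) \<rho> =
     {p. \<forall>\<alpha> q \<sigma>. weak T p \<alpha> q \<and> mtch \<pi> \<alpha> = Some \<sigma> \<and> cond_subst c \<sigma> \<Down> True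
           \<longrightarrow> q \<in> sem T (shml_subst \<phi> \<sigma>) \<rho>}"
| "sem T (LVar X) \<rho> = \<rho> X"
| "sem T (MaxFix X \<phi>) \<rho> = \<Union> {S. S \<subseteq> sem T \<phi> (\<rho>(X := S))}"
  by pat_completeness auto
termination
  by (relation "measure (\<lambda>(T, \<phi>, \<rho>). shml_depth \<phi>)")
     (auto simp: less_Suc_eq_le intro: member_le_sum_list)

text \<open>For closed formulas the valuation is irrelevant.\<close>

definition csem :: "('s, ('k, 'v) act) lts \<Rightarrow> ('k, 'v) shml \<Rightarrow> 's set" where
  "csem T \<phi> = sem T \<phi> (\<lambda>X. {})"

definition satisfiable :: "('s, ('k, 'v) act) lts \<Rightarrow> ('k, 'v) shml \<Rightarrow> bool" where
  "satisfiable T \<phi> \<longleftrightarrow> csem T \<phi> \<noteq> {}"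

definition bisimulation :: "('s, 'a) lts \<Rightarrow> ('s \<Rightarrow> 's \<Rightarrow> bool) \<Rightarrow> bool" where
  "bisimulation T R \<longleftrightarrow>
     (\<forall>p q. R p q \<longrightarrow>
        (\<forall>\<mu> p'. T p \<mu> p' \<longrightarrow> (\<exists>q'. T q \<mu> q' \<and> R p' q')) \<and>
        (\<forall>\<mu> q'. T q \<mu> q' \<longrightarrow> (\<exists>p'. T p \<mu> p' \<and> R p' q')))"

definition bisimilar :: "('s, 'a) lts \<Rightarrow> 's \<Rightarrow> 's \<Rightarrow> bool" where
  "bisimilar T p q \<longleftrightarrow> (\<exists>R. bisimulation T R \<and> R p q)"


section \<open>Transducers\<close>

text \<open>\<open>Ins\<close> and \<open>InsPat\<close> are the label and the pattern written as a bullet.\<close>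

datatype 'a inlab = In 'a | Ins

datatype ('k, 'v) inpat = InPat "('k, 'v) pat" | InsPat

datatype ('k, 'v) outpat = OutPat "('k, 'v) pat" | OutTau

datatype ('k, 'v) trn =
    TId
  | TPre "('k, 'v) inpat" "'v cond" "('k, 'v) outpat" "('k, 'v) trn"
  | TSum "('k, 'v) trn list"
  | TRec rvar "('k, 'v) trn"
  | TVar rvar

primrec inpat_bv :: "('k, 'v) inpat \<Rightarrow> dvar set" where
  "inpat_bv (InPat \<pi>) = pat_bv \<pi>"
| "inpat_bv InsPat = {}"

primrec inpat_fv :: "('k, 'v) inpat \<Rightarrow> dvar set" where
  "inpat_fv (InPat \<pi>) = pat_fv \<pi>"
| "inpat_fv InsPat = {}"

primrec inpat_subst :: "('k, 'v) inpat \<Rightarrow> 'v subst \<Rightarrow> ('k, 'v) inpat" where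
  "inpat_subst (InPat \<pi>) \<sigma> = InPat (pat_subst \<pi> \<sigma>)"
| "inpat_subst InsPat \<sigma> = InsPat"

fun inpat_mtch :: "('k, 'v) inpat \<Rightarrow> ('k, 'v) act inlab \<Rightarrow> 'v subst option" where
  "inpat_mtch (InPat \<pi>) (In \<alpha>) = mtch \<pi> \<alpha>"
| "inpat_mtch InsPat Ins = Some Map.empty"
| "inpat_mtch _ _ = None"

primrec outpat_fv :: "('k, 'v) outpat \<Rightarrow> dvar set" where
  "outpat_fv (OutPat \<pi>) = pat_fv \<pi>"
| "outpat_fv OutTau = {}"

primrec outpat_subst :: "('k, 'v) outpat \<Rightarrow> 'v subst \<Rightarrow> ('k, 'v) outpat" where
  "outpat_subst (OutPat \<pi>) \<sigma> = OutPat (pat_subst \<pi> \<sigma>)"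
| "outpat_subst OutTau \<sigma> = OutTau"

primrec lab_outpat :: "('k, 'v) act lab \<Rightarrow> ('k, 'v) outpat" where
  "lab_outpat (Obs \<alpha>) = OutPat (act_pat \<alpha>)"
| "lab_outpat Tau = OutTau"

primrec trn_dfv :: "('k, 'v) trn \<Rightarrow> dvar set" where
  "trn_dfv TId = {}"
| "trn_dfv (TPre \<pi> c \<pi>' e) =
     inpat_fv \<pi> \<union> ((cond_fv c \<union> outpat_fv \<pi>' \<union> trn_dfv e) - inpat_bv \<pi>)"
| "trn_dfv (TSum es) = \<Union> (set (map trn_dfv es))"
| "trn_dfv (TRec x e) = trn_dfv e"
| "trn_dfv (TVar x) = {}"

primrec trn_rfv :: "('k, 'v) trn \<Rightarrow> rvar set" where
  "trn_rfv TId = {}"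
| "trn_rfv (TPre \<pi> c \<pi>' e) = trn_rfv e"
| "trn_rfv (TSum es) = \<Union> (set (map trn_rfv es))"
| "trn_rfv (TRec x e) = trn_rfv e - {x}"
| "trn_rfv (TVar x) = {x}"

text \<open>In a closed transducer the patterns of outermost prefixes are closed, and those of inner
  prefixes have been closed by the time the prefix is reached.\<close>

definition trn_closed :: "('k, 'v) trn \<Rightarrow> bool" where
  "trn_closed e \<longleftrightarrow> trn_rfv e = {} \<and> trn_dfv e = {}"

primrec trn_subst :: "('k, 'v) trn \<Rightarrow> 'v subst \<Rightarrow> ('k, 'v) trn" where
  "trn_subst TId = (\<lambda>\<sigma>. TId)"
| "trn_subst (TPre \<pi> c \<pi>' e) =
     (\<lambda>\<sigma>. TPre (inpat_subst \<pi> \<sigma>) (cond_subst c (\<sigma> |` (- inpat_bv \<pi>)))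
               (outpat_subst \<pi>' (\<sigma> |` (- inpat_bv \<pi>))) (trn_subst e (\<sigma> |` (- inpat_bv \<pi>))))"
| "trn_subst (TSum es) = (\<lambda>\<sigma>. TSum (map (\<lambda>f. f \<sigma>) (map trn_subst es)))"
| "trn_subst (TRec x e) = (\<lambda>\<sigma>. TRec x (trn_subst e \<sigma>))"
| "trn_subst (TVar x) = (\<lambda>\<sigma>. TVar x)"

text \<open>\<open>trn_unfold e x f\<close> is \<open>e[f/x]\<close>. It does not rename binders, so it is the intended
  substitution only for closed \<open>f\<close>; transitions of closed transducers use no other instance.\<close>

primrec trn_unfold :: "('k, 'v) trn \<Rightarrow> rvar \<Rightarrow> ('k, 'v) trn \<Rightarrow> ('k, 'v) trn" where
  "trn_unfold TId x f = TId"
| "trn_unfold (TPre \<pi> c \<pi>' e) x f = TPre \<pi> c \<pi>' (trn_unfold e x f)"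
| "trn_unfold (TSum es) x f = TSum (map (\<lambda>e. trn_unfold e x f) es)"
| "trn_unfold (TRec y e) x f = TRec y (if y = x then e else trn_unfold e x f)"
| "trn_unfold (TVar y) x f = (if y = x then f else TVar y)"

inductive trn_step ::
  "('k, 'v) trn \<Rightarrow> ('k, 'v) act inlab \<Rightarrow> ('k, 'v) act lab \<Rightarrow> ('k, 'v) trn \<Rightarrow> bool" where
  eId: "trn_step TId (In \<alpha>) (Obs \<alpha>) TId"
| ePre: "inpat_mtch \<pi> \<gamma> = Some \<sigma> \<Longrightarrow> cond_subst c \<sigma> \<Down> True \<Longrightarrow>
    lab_outpat \<mu> = outpat_subst \<pi>' \<sigma> \<Longrightarrow> trn_step (TPre \<pi> c \<pi>' e) \<gamma> \<mu> (trn_subst e \<sigma>)"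
| eSum: "e \<in> set es \<Longrightarrow> trn_step e \<gamma> \<mu> e' \<Longrightarrow> trn_step (TSum es) \<gamma> \<mu> e'"
| eRec: "trn_step (trn_unfold e x (TRec x e)) \<gamma> \<mu> e' \<Longrightarrow> trn_step (TRec x e) \<gamma> \<mu> e'"


section \<open>Monitored systems and enforcement\<close>

text \<open>The states are the system states and the monitored systems \<open>e[p]\<close>.\<close>

datatype ('s, 'k, 'v) mstate = Sys 's | Mon "('k, 'v) trn" 's

inductive mon_lts ::
  "('s, ('k, 'v) act) lts \<Rightarrow> (('s, 'k, 'v) mstate, ('k, 'v) act) lts" for T where
  sys: "T p \<mu> p' \<Longrightarrow> mon_lts T (Sys p) \<mu> (Sys p')"
| iTrn: "T p (Obs \<alpha>) p' \<Longrightarrow> trn_step e (In \<alpha>) \<mu> e' \<Longrightarrow> mon_lts T (Mon e p) \<mu> (Mon e' p')"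
| iAsy: "T p Tau p' \<Longrightarrow> mon_lts T (Mon e p) Tau (Mon e p')"
| iIns: "trn_step e Ins \<mu> e' \<Longrightarrow> mon_lts T (Mon e p) \<mu> (Mon e' p)"
| iTer: "T p (Obs \<alpha>) p' \<Longrightarrow> \<nexists>\<mu> e'. trn_step e (In \<alpha>) \<mu> e' \<Longrightarrow> \<nexists>\<mu> e'. trn_step e Ins \<mu> e' \<Longrightarrow>
    mon_lts T (Mon e p) (Obs \<alpha>) (Mon TId p')"

definition enforces ::
  "('s, ('k, 'v) act) lts \<Rightarrow> ('k, 'v) trn \<Rightarrow> ('k, 'v) shml \<Rightarrow> bool" where
  "enforces T e \<phi> \<longleftrightarrow>
     (\<forall>p. satisfiable T \<phi> \<longrightarrow> Mon e p \<in> csem (mon_lts T) \<phi>) \<and>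
     (\<forall>p. p \<in> csem T \<phi> \<longrightarrow> bisimilar (mon_lts T) (Mon e p) (Sys p))"

end

theory Submission
  imports Defs
begin

text \<open>A necessity is monitored by a prefix that forwards the matching actions, except that for
  \<open>[{\<pi>, c}]ff\<close> it suppresses them and returns to the enclosing conjunction. For soundness, a maximal
  fixed point needs only one witness: the monitored systems whose transducer is reached from the
  synthesised one by silent steps form a post-fixed point. For transparency, a system that satisfies
  the formula never performs a suppressed action, so the transducer forwards everything.\<close>

section \<open>Data substitution\<close>

text \<open>A suppressed action becomes a silent step, while necessities speak of weak transitions:
  after a suppression the monitored system is still inside the same weak transition. Returning to
  the conjunction keeps every branch guarded there. Disjointness of the branches makes this
  reliable: an action that one branch must suppress cannot slip through another branch. The formula
  \<open>FF\<close> is never enforced on its own. At top level both requirements are vacuous for it;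
  directly below a maximal fixed point it is excluded because the bound variable has to occur; below
  a necessity the prefix deals with it. Formulas are never unfolded. A free logical variable is
  interpreted twice, by a transducer in \<open>\<eta>\<close> and by a set of states in
  \<open>\<rho>\<close>, and unfolding a recursion amounts to updating
  \<open>\<eta>\<close>.\<close>

lemma pat_bv_subst [simp]: "pat_bv (pat_subst \<pi> \<sigma>) = pat_bv \<pi>"
proof -
  have "PBind x = arg_subst a \<tau> \<longleftrightarrow> a = PBind x" for a :: "'b parg" and \<tau> x
    by (cases a) (auto split: option.splits)
  then show ?thesis
    by (cases \<pi>) (simp add: pat_subst_def image_iff)
qed

lemma arg_subst_eq_PVar_iff: "arg_subst a \<sigma> = PVar x \<longleftrightarrow> a = PVar x \<and> x \<notin> dom \<sigma>"
  by (cases a) (auto split: option.splits)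

lemma pat_fv_subst: "pat_fv (pat_subst \<pi> \<sigma>) \<subseteq> pat_fv \<pi> - dom \<sigma>"
proof
  fix x assume x: "x \<in> pat_fv (pat_subst \<pi> \<sigma>)"
  obtain k as where \<pi>: "\<pi> = Pat k as" by (cases \<pi>)
  have "x \<notin> pat_bv \<pi>" using x pat_bv_subst[of \<pi> \<sigma>] by (cases "pat_subst \<pi> \<sigma>") auto
  moreover have "\<exists>a\<in>set as. arg_subst a (\<sigma> |` (- pat_bv \<pi>)) = PVar x"
    using x \<pi> by (force simp: pat_subst_def)
  ultimately show "x \<in> pat_fv \<pi> - dom \<sigma>"
    using \<pi> by (auto simp: arg_subst_eq_PVar_iff)
qed

text \<open>The right argument of \<open>++\<close> takes precedence: once \<open>\<sigma>\<close>
  has replaced a variable, \<open>\<tau>\<close> no longer sees it.\<close>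

lemma pat_subst_subst: "pat_subst (pat_subst \<pi> \<sigma>) \<tau> = pat_subst \<pi> (\<tau> ++ \<sigma>)"
proof -
  have "arg_subst (arg_subst a (\<sigma> |` A)) (\<tau> |` A) = arg_subst a ((\<tau> ++ \<sigma>) |` A)"
    for a :: "'b parg" and A
    by (cases a) (auto simp: restrict_map_def map_add_def split: option.splits)
  moreover have "pat_subst (pat_subst \<pi> \<sigma>) \<tau> = (case pat_subst \<pi> \<sigma> of Pat k as \<Rightarrow>
      Pat k (map (\<lambda>a. arg_subst a (\<tau> |` (- pat_bv \<pi>))) as))"
    unfolding pat_subst_def[of "pat_subst \<pi> \<sigma>"] pat_bv_subst ..
  ultimately show ?thesis
    by (cases \<pi>) (simp add: pat_subst_def)
qed

lemma pat_subst_ident: "pat_fv \<pi> \<inter> dom \<sigma> = {} \<Longrightarrow> pat_subst \<pi> \<sigma> = \<pi>"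
proof (cases \<pi>)
  case (Pat k as)
  assume "pat_fv \<pi> \<inter> dom \<sigma> = {}"
  with Pat have *: "\<sigma> x = None" if "PVar x \<in> set as" "x \<notin> pat_bv \<pi>" for x
    using that by auto
  have "arg_subst a (\<sigma> |` (- pat_bv \<pi>)) = a" if "a \<in> set as" for a
    by (cases a; use that * in \<open>auto simp: restrict_map_def simp del: pat_bv.simps\<close>)
  then show ?thesis using Pat by (simp add: pat_subst_def map_idI)
qed

lemma pat_bv_unbind [simp]: "pat_bv (pat_unbind \<pi>) = {}"
proof -
  have "arg_unbind a \<noteq> PBind x" for a :: "'b parg" and x by (cases a) auto
  then show ?thesis by (cases \<pi>) (auto simp: image_iff, metis)
qed

lemma pat_fv_unbind: "pat_fv (pat_unbind \<pi>) \<subseteq> pat_fv \<pi> \<union> pat_bv \<pi>"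
proof -
  have "arg_unbind a = PVar x \<Longrightarrow> a = PVar x \<or> a = PBind x" for a :: "'b parg" and x
    by (cases a) auto
  then show ?thesis by (cases \<pi>) (auto simp: image_iff, metis+)
qed

text \<open>Unbinding frees the binders of \<open>\<pi>\<close>, which \<open>\<sigma>\<close> must
  not capture; hence the restriction. This makes the output of a forwarding prefix commute with
  instantiation.\<close>

lemma pat_unbind_subst:
  "pat_subst (pat_unbind \<pi>) (\<sigma> |` (- pat_bv \<pi>)) = pat_unbind (pat_subst \<pi> \<sigma>)"
proof (cases \<pi>)
  case (Pat k as)
  have "arg_subst (arg_unbind a) (\<sigma> |` (- pat_bv \<pi>)) =
      arg_unbind (arg_subst a (\<sigma> |` (- pat_bv \<pi>)))"
    if "a \<in> set as" for a
  proof (cases a)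
    case (PBind x)
    with that Pat have "x \<in> pat_bv \<pi>" by simp
    with PBind show ?thesis by (simp add: restrict_map_def del: pat_bv.simps)
  qed (auto split: option.splits)
  then show ?thesis
    using pat_bv_unbind[of \<pi>] Pat by (simp add: pat_subst_def Compl_empty_eq del: pat_bv_unbind)
qed

lemma act_pat_inject: "act_pat \<alpha> = act_pat \<beta> \<longleftrightarrow> \<alpha> = \<beta>"
  by (cases \<alpha>; cases \<beta>) (auto simp: inj_map_eq_map inj_def)

lemma vterm_subst_subst: "vterm_subst (vterm_subst t \<sigma>) \<tau> = vterm_subst t (\<tau> ++ \<sigma>)"
  by (cases t) (auto simp: map_add_def split: option.splits)

lemma cond_subst_subst: "cond_subst (cond_subst c \<sigma>) \<tau> = cond_subst c (\<tau> ++ \<sigma>)"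
  by (induction c) (auto simp: vterm_subst_subst)

lemma cond_subst_ident: "cond_fv c \<inter> dom \<sigma> = {} \<Longrightarrow> cond_subst c \<sigma> = c"
proof (induction c)
  case (CAtom P ts)
  have "vterm_subst t \<sigma> = t" if "t \<in> set ts" for t
    by (cases t; use that CAtom in \<open>auto split: option.splits\<close>)
  then show ?case by (simp add: map_idI)
qed auto

lemma cond_fv_subst: "cond_fv (cond_subst c \<sigma>) \<subseteq> cond_fv c - dom \<sigma>"
proof (induction c)
  case (CAtom P ts)
  have "DVar x = vterm_subst t \<sigma> \<longleftrightarrow> t = DVar x \<and> x \<notin> dom \<sigma>" for t x
    by (cases t) (auto split: option.splits)
  then show ?case by (auto simp: image_iff)
qed auto

section \<open>Instances of formulas and preservation of normal forms\<close>

lemma shml_dfv_subst: "shml_dfv (shml_subst \<phi> \<sigma>) \<subseteq> shml_dfv \<phi> - dom \<sigma>"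
proof (induction \<phi> arbitrary: \<sigma>)
  case (Conj \<phi>s)
  then show ?case by fastforce
next
  case (Nec \<pi> c \<phi>)
  have "shml_dfv (shml_subst \<phi> (\<sigma> |` (- pat_bv \<pi>))) \<subseteq> shml_dfv \<phi> - dom (\<sigma> |` (- pat_bv \<pi>))"
    by (rule Nec)
  with pat_fv_subst[of \<pi> \<sigma>] cond_fv_subst[of c "\<sigma> |` (- pat_bv \<pi>)"] show ?case
    by auto
qed auto

lemma shml_lfv_subst [simp]: "shml_lfv (shml_subst \<phi> \<sigma>) = shml_lfv \<phi>"
  by (induction \<phi> arbitrary: \<sigma>) auto

lemma shml_subst_eq_FF_iff [simp]: "shml_subst \<phi> \<sigma> = FF \<longleftrightarrow> \<phi> = FF"
  by (cases \<phi>) auto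

text \<open>An instance of an instance is again an instance, under
  \<open>\<tau> ++ \<sigma>\<close>, and \<open>sym_disjoint\<close> quantifies over all instances.
  Normal forms therefore survive the instantiation performed when a necessity is passed.\<close>

lemma sym_disjoint_subst:
  assumes "sym_disjoint \<pi> c \<pi>' c'"
  shows "sym_disjoint (pat_subst \<pi> \<sigma>) (cond_subst c (\<sigma> |` (- pat_bv \<pi>)))
    (pat_subst \<pi>' \<sigma>) (cond_subst c' (\<sigma> |` (- pat_bv \<pi>')))"
proof -
  have "(\<tau> |` A) ++ (\<sigma> |` A) = (\<tau> ++ \<sigma>) |` A" for \<tau> :: "'b subst" and A
    by (auto simp: restrict_map_def map_add_def)
  with assms show ?thesis
    by (auto simp: sym_disjoint_def pat_subst_subst cond_subst_subst)
qed

lemma shml_nf_subst: "shml_nf \<phi> \<Longrightarrow> shml_nf (shml_subst \<phi> \<sigma>)"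
proof (induction arbitrary: \<sigma> rule: shml_nf.induct)
  case (3 bs)
  let ?f = "\<lambda>(\<pi>, c, \<phi>). (pat_subst \<pi> \<sigma>, cond_subst c (\<sigma> |` (- pat_bv \<pi>)),
    shml_subst \<phi> (\<sigma> |` (- pat_bv \<pi>)))"
  have "shml_nf (Conj (map (\<lambda>(\<pi>, c, \<phi>). Nec \<pi> c \<phi>) (map ?f bs)))"
  proof (rule shml_nf.intros(3), goal_cases)
    case 1
    then show ?case using 3(1) by (auto split: prod.splits)
  next
    case 2
    show ?case
    proof (intro allI impI)
      fix j h assume "j < length (map ?f bs)" "h < length (map ?f bs)" "j \<noteq> h"
      with 3(2) have "sym_disjoint (fst (bs ! j)) (fst (snd (bs ! j))) (fst (bs ! h)) (fst (snd (bs ! h)))"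
        "j < length bs" "h < length bs" by auto
      then show "sym_disjoint (fst (map ?f bs ! j)) (fst (snd (map ?f bs ! j)))
          (fst (map ?f bs ! h)) (fst (snd (map ?f bs ! h)))"
        by (auto split: prod.splits dest: sym_disjoint_subst)
    qed
  qed
  moreover have "shml_subst (Conj (map (\<lambda>(\<pi>, c, \<phi>). Nec \<pi> c \<phi>) bs)) \<sigma> =
      Conj (map (\<lambda>(\<pi>, c, \<phi>). Nec \<pi> c \<phi>) (map ?f bs))"
    by auto
  ultimately show ?case by (simp only:)
qed (auto intro: shml_nf.intros)

lemma shml_nf_ConjE:
  assumes "shml_nf (Conj \<phi>s)" and "\<psi> \<in> set \<phi>s"
  obtains \<pi> c \<phi> where "\<psi> = Nec \<pi> c \<phi>" "shml_nf \<phi>"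
  using assms(1)
proof cases
  case (3 bs)
  with assms(2) obtain i where "i < length bs" "\<psi> = (\<lambda>(\<pi>, c, \<phi>). Nec \<pi> c \<phi>) (bs ! i)"
    by (auto simp: in_set_conv_nth)
  with 3 that show thesis by (cases "bs ! i") auto
qed

lemma shml_nf_Conj_unique:
  assumes "shml_nf (Conj \<phi>s)" and "Nec \<pi> c \<phi> \<in> set \<phi>s" and "Nec \<pi>' c' \<phi>' \<in> set \<phi>s"
    and "\<alpha> \<in> sym_den \<pi> c" and "\<alpha> \<in> sym_den \<pi>' c'"
  shows "\<pi> = \<pi>' \<and> c = c' \<and> \<phi> = \<phi>'"
  using assms(1)
proof cases
  case (3 bs)
  from 3 assms(2) obtain i where i: "i < length bs" "bs ! i = (\<pi>, c, \<phi>)"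
    by (auto simp: in_set_conv_nth)
  from 3 assms(3) obtain j where j: "j < length bs" "bs ! j = (\<pi>', c', \<phi>')"
    by (auto simp: in_set_conv_nth)
  have "i = j"
  proof (rule ccontr)
    assume "i \<noteq> j"
    with 3 i j have "sym_disjoint \<pi> c \<pi>' c'" by fastforce
    \<comment> \<open>The instance under the empty substitution is the symbolic action
      itself.\<close>
    then have "sym_den (pat_subst \<pi> Map.empty) (cond_subst c (Map.empty |` (- pat_bv \<pi>)))
        \<inter> sym_den (pat_subst \<pi>' Map.empty) (cond_subst c' (Map.empty |` (- pat_bv \<pi>'))) = {}"
      unfolding sym_disjoint_def by blast
    with assms(4,5) show False by (auto simp: pat_subst_ident cond_subst_ident)
  qed
  with i j show ?thesis by simp
qed

section \<open>Transducers unaffected by substitution or unfolding\<close>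

lemma trn_subst_ident: "trn_dfv e \<inter> dom \<sigma> = {} \<Longrightarrow> trn_subst e \<sigma> = e"
proof (induction e arbitrary: \<sigma>)
  case (TPre \<pi> c \<pi>' e)
  have "inpat_subst \<pi> \<sigma> = \<pi>"
    using TPre.prems by (cases \<pi>) (auto intro!: pat_subst_ident)
  moreover have "cond_subst c (\<sigma> |` (- inpat_bv \<pi>)) = c"
    using TPre.prems by (intro cond_subst_ident) auto
  moreover have "outpat_subst \<pi>' (\<sigma> |` (- inpat_bv \<pi>)) = \<pi>'"
    using TPre.prems by (cases \<pi>') (auto intro!: pat_subst_ident simp: restrict_map_def split: if_splits)
  moreover have "trn_subst e (\<sigma> |` (- inpat_bv \<pi>)) = e"
    using TPre.prems by (intro TPre.IH) auto
  ultimately show ?case by simp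
next
  case (TSum es)
  have "trn_subst e \<sigma> = e" if "e \<in> set es" for e
    using that TSum.prems by (intro TSum.IH) auto
  then show ?case by (simp add: map_idI)
qed auto

lemma trn_unfold_ident: "x \<notin> trn_rfv e \<Longrightarrow> trn_unfold e x f = e"
  by (induction e) (auto intro!: map_idI)


section \<open>Synthesis\<close>

text \<open>The second argument interprets the free logical variables. The logical variable \<open>X\<close> becomes
  the recursion variable \<open>Suc X\<close>, so \<open>0\<close> is available for the recursion added at each conjunction
  to return there after a suppression. Nested conjunctions can all use \<open>0\<close>, because it occurs only
  directly below a prefix of its own conjunction.\<close>

primrec synth :: "('k, 'v) shml \<Rightarrow> (lvar \<Rightarrow> ('k, 'v) trn) \<Rightarrow> ('k, 'v) trn" where
  "synth TT = (\<lambda>\<eta>. TId)"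
| "synth FF = (\<lambda>\<eta>. TId)"
| "synth (Conj \<phi>s) = (\<lambda>\<eta>. TRec 0 (TSum (map (\<lambda>f. f \<eta>) (map synth \<phi>s))))"
| "synth (Nec \<pi> c \<phi>) = (\<lambda>\<eta>. if \<phi> = FF then TPre (InPat \<pi>) c OutTau (TVar 0)
     else TPre (InPat \<pi>) c (OutPat (pat_unbind \<pi>)) (synth \<phi> \<eta>))"
| "synth (LVar X) = (\<lambda>\<eta>. \<eta> X)"
| "synth (MaxFix X \<phi>) = (\<lambda>\<eta>. TRec (Suc X) (synth \<phi> (\<eta>(X := TVar (Suc X)))))"

lemma trn_dfv_synth:
  "(\<And>X. trn_dfv (\<eta> X) = {}) \<Longrightarrow> trn_dfv (synth \<phi> \<eta>) \<subseteq> shml_dfv \<phi>"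
proof (induction \<phi> arbitrary: \<eta>)
  case (Nec \<pi> c \<phi>)
  have "trn_dfv (synth \<phi> \<eta>) \<subseteq> shml_dfv \<phi>" using Nec by blast
  with pat_fv_unbind[of \<pi>] show ?case by auto
next
  case (MaxFix X \<phi>)
  have "trn_dfv (synth \<phi> (\<eta>(X := TVar (Suc X)))) \<subseteq> shml_dfv \<phi>"
    by (rule MaxFix.IH) (simp add: MaxFix.prems)
  then show ?case by simp
qed (fastforce)+

text \<open>The environment contributes no free data variables, so \<open>\<sigma>\<close> acts only
  on the formula; and the test for \<open>FF\<close> in \<open>synth\<close> gives the same answer
  before and after instantiation.\<close>

lemma trn_subst_synth:
  "(\<And>X. trn_dfv (\<eta> X) = {}) \<Longrightarrow> trn_subst (synth \<phi> \<eta>) \<sigma> = synth (shml_subst \<phi> \<sigma>) \<eta>"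
  by (induction \<phi> arbitrary: \<eta> \<sigma>) (auto simp: pat_unbind_subst trn_subst_ident)

text \<open>A bare necessity over \<open>FF\<close> would leave \<open>0\<close> free. In a normal
  form each necessity stands directly under a conjunction, whose \<open>TRec 0\<close> binds it, so
  only the environment contributes free recursion variables.\<close>

lemma trn_rfv_synth:
  assumes "shml_nf \<phi>"
  shows "trn_rfv (synth \<phi> \<eta>) \<subseteq> (\<Union>X\<in>shml_lfv \<phi>. trn_rfv (\<eta> X))"
  using assms
proof (induction arbitrary: \<eta> rule: shml_nf.induct)
  case (3 bs)
  have *: "trn_rfv (synth \<phi> \<eta>) \<subseteq> (\<Union>X\<in>shml_lfv \<phi>. trn_rfv (\<eta> X))"
    if "(\<pi>, c, \<phi>) \<in> set bs" for \<pi> c \<phi>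
    using that 3(1) by (metis in_set_conv_nth snd_conv)
  show ?case
  proof
    fix x assume "x \<in> trn_rfv (synth (Conj (map (\<lambda>(\<pi>, c, \<phi>). Nec \<pi> c \<phi>) bs)) \<eta>)"
    then obtain \<pi> c \<phi> where mem: "(\<pi>, c, \<phi>) \<in> set bs" and "x \<in> trn_rfv (synth \<phi> \<eta>)"
      by (auto split: if_splits)
    with * obtain Y where "Y \<in> shml_lfv \<phi>" "x \<in> trn_rfv (\<eta> Y)" by blast
    with mem show "x \<in> (\<Union>X\<in>shml_lfv (Conj (map (\<lambda>(\<pi>, c, \<phi>). Nec \<pi> c \<phi>) bs)). trn_rfv (\<eta> X))"
      by force
  qed
next
  case (5 \<phi> X)
  have "(\<Union>Y\<in>shml_lfv \<phi>. trn_rfv ((\<eta>(X := TVar (Suc X))) Y)) \<subseteq>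
      insert (Suc X) (\<Union>Y\<in>shml_lfv \<phi> - {X}. trn_rfv (\<eta> Y))"
    by (auto split: if_splits)
  with "5.IH"[of "\<eta>(X := TVar (Suc X))"]
  have "trn_rfv (synth \<phi> (\<eta>(X := TVar (Suc X)))) \<subseteq>
      insert (Suc X) (\<Union>Y\<in>shml_lfv \<phi> - {X}. trn_rfv (\<eta> Y))"
    by (rule subset_trans)
  then show ?case by auto
qed auto

text \<open>Term unfolding becomes an update of the environment. The variable \<open>Suc X\<close>
  is reached only through \<open>\<eta> X\<close>: the other entries avoid it, the recursion at a
  conjunction binds \<open>0\<close>, and an inner fixed point over \<open>X\<close> shadows both
  the variable and the update.\<close>

lemma trn_unfold_synth:
  assumes "\<And>Y. Y \<noteq> X \<Longrightarrow> Suc X \<notin> trn_rfv (\<eta> Y)"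
  shows "trn_unfold (synth \<phi> \<eta>) (Suc X) f = synth \<phi> (\<eta>(X := trn_unfold (\<eta> X) (Suc X) f))"
  using assms
proof (induction \<phi> arbitrary: \<eta>)
  case (MaxFix Y \<phi>)
  show ?case
  proof (cases "Y = X")
    case False
    have "trn_unfold (synth \<phi> (\<eta>(Y := TVar (Suc Y)))) (Suc X) f =
        synth \<phi> ((\<eta>(Y := TVar (Suc Y)))(X := trn_unfold (\<eta> X) (Suc X) f))"
      using False MaxFix by (subst MaxFix.IH) auto
    with False show ?thesis by (simp add: fun_upd_twist del: fun_upd_apply)
  qed (simp del: fun_upd_apply)
qed (auto simp: trn_unfold_ident)

definition closed_env :: "(lvar \<Rightarrow> ('k, 'v) trn) \<Rightarrow> bool" where
  "closed_env \<eta> \<longleftrightarrow> (\<forall>X. trn_closed (\<eta> X))"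

lemma trn_closed_synth:
  assumes "shml_nf \<phi>" and "shml_dfv \<phi> = {}" and "closed_env \<eta>"
  shows "trn_closed (synth \<phi> \<eta>)"
  using trn_rfv_synth[OF assms(1), of \<eta>] trn_dfv_synth[of \<eta> \<phi>] assms(2,3)
  by (auto simp: trn_closed_def closed_env_def)

lemma closed_env_upd: "closed_env \<eta> \<Longrightarrow> trn_closed e \<Longrightarrow> closed_env (\<eta>(X := e))"
  by (simp add: closed_env_def)

section \<open>Transitions of synthesised transducers\<close>

inductive_cases TPre_stepE: "trn_step (TPre \<pi> c \<pi>' e) \<gamma> \<mu> e'"
inductive_cases TSum_stepE: "trn_step (TSum es) \<gamma> \<mu> e'"
inductive_cases TRec_stepE: "trn_step (TRec x e) \<gamma> \<mu> e'"

lemma trn_step_TRec_iff: "trn_step (TRec x e) \<gamma> \<mu> e' \<longleftrightarrow> trn_step (trn_unfold e x (TRec x e)) \<gamma> \<mu> e'"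
  by (auto elim: TRec_stepE intro: eRec)

lemma trn_unfold_MaxFix:
  assumes "closed_env \<eta>"
  shows "trn_unfold (synth \<phi> (\<eta>(X := TVar (Suc X)))) (Suc X) (synth (MaxFix X \<phi>) \<eta>) =
    synth \<phi> (\<eta>(X := synth (MaxFix X \<phi>) \<eta>))"
  using assms by (subst trn_unfold_synth) (auto simp: closed_env_def trn_closed_def)

lemma trn_step_Conj_iff:
  assumes nf: "shml_nf (Conj \<phi>s)" and dfv: "shml_dfv (Conj \<phi>s) = {}" and \<eta>: "closed_env \<eta>"
  shows "trn_step (synth (Conj \<phi>s) \<eta>) \<gamma> \<mu> e' \<longleftrightarrow>
    (\<exists>\<pi> c \<phi> \<alpha> \<sigma>. Nec \<pi> c \<phi> \<in> set \<phi>s \<and> \<gamma> = In \<alpha> \<and> mtch \<pi> \<alpha> = Some \<sigma> \<and> cond_subst c \<sigma> \<Down> True \<and>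
      (if \<phi> = FF then \<mu> = Tau \<and> e' = synth (Conj \<phi>s) \<eta>
       else \<mu> = Obs \<alpha> \<and> e' = synth (shml_subst \<phi> \<sigma>) \<eta>))"
    (is "?L \<longleftrightarrow> ?R")
proof -
  let ?E = "synth (Conj \<phi>s) \<eta>"
  \<comment> \<open>After unfolding, a suppressing prefix continues with \<open>?E\<close>, to which
    the matching substitution is then applied; closedness makes this harmless.\<close>
  have E_closed: "trn_subst ?E \<sigma> = ?E" for \<sigma>
    using trn_closed_synth[OF nf dfv \<eta>] by (intro trn_subst_ident) (simp add: trn_closed_def)
  have branch: "trn_step (trn_unfold (synth \<psi> \<eta>) 0 ?E) \<gamma> \<mu> e' \<longleftrightarrow>
    (\<exists>\<pi> c \<phi> \<alpha> \<sigma>. Nec \<pi> c \<phi> = \<psi> \<and> \<gamma> = In \<alpha> \<and> mtch \<pi> \<alpha> = Some \<sigma> \<and> cond_subst c \<sigma> \<Down> True \<and>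
      (if \<phi> = FF then \<mu> = Tau \<and> e' = ?E else \<mu> = Obs \<alpha> \<and> e' = synth (shml_subst \<phi> \<sigma>) \<eta>))"
    if \<psi>: "\<psi> \<in> set \<phi>s" for \<psi>
  proof -
    obtain \<pi> c \<phi> where \<psi>_eq: "\<psi> = Nec \<pi> c \<phi>" and nf\<phi>: "shml_nf \<phi>"
      using shml_nf_ConjE[OF nf \<psi>] by blast
    show ?thesis
    proof (cases "\<phi> = FF")
      case True
      have "trn_step (TPre (InPat \<pi>) c OutTau ?E) \<gamma> \<mu> e' \<longleftrightarrow>
        (\<exists>\<alpha> \<sigma>. \<gamma> = In \<alpha> \<and> mtch \<pi> \<alpha> = Some \<sigma> \<and> cond_subst c \<sigma> \<Down> True \<and> \<mu> = Tau \<and> e' = ?E)"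
        (is "?l \<longleftrightarrow> ?r")
      proof
        assume ?l
        then show ?r by (cases \<gamma>; cases \<mu>) (auto elim!: TPre_stepE simp: E_closed simp del: synth.simps)
      next
        assume ?r
        then obtain \<alpha> \<sigma> where *: "\<gamma> = In \<alpha>" "mtch \<pi> \<alpha> = Some \<sigma>" "cond_subst c \<sigma> \<Down> True" "\<mu> = Tau" "e' = ?E"
          by blast
        have "trn_step (TPre (InPat \<pi>) c OutTau ?E) (In \<alpha>) Tau (trn_subst ?E \<sigma>)"
          by (rule ePre) (use * in auto)
        with * E_closed show ?l by metis
      qed
      then show ?thesis using True \<psi>_eq by simp
    next
      case False
      \<comment> \<open>The continuation is closed, so the recursion added at this conjunction does
        not reach into it.\<close>
      have "trn_unfold (synth \<phi> \<eta>) 0 ?E = synth \<phi> \<eta>"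
        using trn_rfv_synth[OF nf\<phi>, of \<eta>] \<eta>
        by (intro trn_unfold_ident) (auto simp: closed_env_def trn_closed_def)
      moreover have sub: "trn_subst (synth \<phi> \<eta>) \<sigma> = synth (shml_subst \<phi> \<sigma>) \<eta>" for \<sigma>
        using \<eta> by (intro trn_subst_synth) (auto simp: closed_env_def trn_closed_def)
      \<comment> \<open>Matching is defined by instantiating the unbound pattern, so this output
        pattern re-emits exactly the action that was read.\<close>
      moreover have out: "lab_outpat \<mu> = outpat_subst (OutPat (pat_unbind \<pi>)) \<sigma> \<longleftrightarrow> \<mu> = Obs \<alpha>"
        if "mtch \<pi> \<alpha> = Some \<sigma>" for \<alpha> \<sigma>
        using that by (cases \<mu>) (auto simp: mtch_Some_iff matches_def act_pat_inject)
      have "trn_step (TPre (InPat \<pi>) c (OutPat (pat_unbind \<pi>)) (synth \<phi> \<eta>)) \<gamma> \<mu> e' \<longleftrightarrow>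
        (\<exists>\<alpha> \<sigma>. \<gamma> = In \<alpha> \<and> mtch \<pi> \<alpha> = Some \<sigma> \<and> cond_subst c \<sigma> \<Down> True \<and> \<mu> = Obs \<alpha> \<and>
           e' = synth (shml_subst \<phi> \<sigma>) \<eta>)"
        (is "?l \<longleftrightarrow> ?r")
      proof
        assume ?l
        then show ?r
        proof (rule TPre_stepE)
          fix \<sigma> assume *: "e' = trn_subst (synth \<phi> \<eta>) \<sigma>" "inpat_mtch (InPat \<pi>) \<gamma> = Some \<sigma>"
            "cond_subst c \<sigma> \<Down> True" "lab_outpat \<mu> = outpat_subst (OutPat (pat_unbind \<pi>)) \<sigma>"
          then obtain \<alpha> where "\<gamma> = In \<alpha>" "mtch \<pi> \<alpha> = Some \<sigma>" by (cases \<gamma>) auto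
          with * out sub show ?r by metis
        qed
      next
        assume ?r
        then obtain \<alpha> \<sigma> where *: "\<gamma> = In \<alpha>" "mtch \<pi> \<alpha> = Some \<sigma>" "cond_subst c \<sigma> \<Down> True"
          "\<mu> = Obs \<alpha>" "e' = synth (shml_subst \<phi> \<sigma>) \<eta>"
          by blast
        have "trn_step (TPre (InPat \<pi>) c (OutPat (pat_unbind \<pi>)) (synth \<phi> \<eta>)) \<gamma> \<mu>
            (trn_subst (synth \<phi> \<eta>) \<sigma>)"
          by (rule ePre) (use * out in auto)
        with * sub show ?l by metis
      qed
      ultimately show ?thesis using False \<psi>_eq by simp
    qed
  qed
  have "?L \<longleftrightarrow> (\<exists>\<psi>\<in>set \<phi>s. trn_step (trn_unfold (synth \<psi> \<eta>) 0 ?E) \<gamma> \<mu> e')"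
    by (auto simp: trn_step_TRec_iff elim!: TSum_stepE intro!: eSum)
  also have "\<dots> \<longleftrightarrow> ?R" using branch by blast
  finally show ?thesis .
qed


section \<open>Soundness\<close>

definition step_equiv :: "('k, 'v) trn \<Rightarrow> ('k, 'v) trn \<Rightarrow> bool" where
  "step_equiv e f \<longleftrightarrow> trn_step e = trn_step f"

text \<open>Closing under \<^const>\<open>step_equiv\<close> identifies a recursion with its unfolding, which have the same
  transitions but are different terms.\<close>

inductive tau_deriv :: "('k, 'v) trn \<Rightarrow> ('k, 'v) trn \<Rightarrow> bool" for e where
  refl: "step_equiv f e \<Longrightarrow> tau_deriv e f"
| step: "tau_deriv e f \<Longrightarrow> trn_step f \<gamma> Tau f' \<Longrightarrow> tau_deriv e f'"

lemma tau_deriv_self [intro!]: "tau_deriv e e"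
  by (rule tau_deriv.refl) (simp add: step_equiv_def)

lemma tau_deriv_step_equiv: "step_equiv e e' \<Longrightarrow> tau_deriv e f \<longleftrightarrow> tau_deriv e' f"
proof -
  have "tau_deriv e' f" if "tau_deriv e f" and "step_equiv e e'" for e e' f :: "('k, 'v) trn"
    using that by induction (auto intro: tau_deriv.intros simp: step_equiv_def)
  then show "step_equiv e e' \<Longrightarrow> tau_deriv e f \<longleftrightarrow> tau_deriv e' f"
    by (metis step_equiv_def)
qed

text \<open>A silent move of a monitored system is either one of the system, which leaves the
  transducer alone, or a silent output of the transducer. The default rule \<open>iTer\<close> is
  always visible.\<close>

lemma mon_lts_taus:
  assumes "(\<lambda>r r'. mon_lts T r Tau r')\<^sup>*\<^sup>* (Mon f p) r" and "tau_deriv e f"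
  shows "\<exists>g q. r = Mon g q \<and> tau_deriv e g"
  using assms(1)
proof induction
  case base
  then show ?case using assms(2) by blast
next
  case (step r r')
  then show ?case by (auto elim!: mon_lts.cases intro: tau_deriv.step)
qed

text \<open>The induction is on depth because a necessity continues with the instance
  \<open>shml_subst \<psi> \<sigma>\<close>, which need not be a subformula but is no deeper than
  \<open>\<psi>\<close>. Admitting every \<open>f\<close> derived silently from the synthesised
  transducer covers the silent moves around the visible action of a weak transition. The assumption
  on \<open>\<rho>\<close> is the same claim for free variables.\<close>

lemma synth_sound:
  fixes T :: "('s, ('k, 'v) act) lts"
    and \<phi> :: "('k, 'v) shml"
  assumes "shml_nf \<phi>" and "\<phi> \<noteq> FF" and "shml_dfv \<phi> = {}" and "closed_env \<eta>"
    and "\<And>X f p. X \<in> shml_lfv \<phi> \<Longrightarrow> tau_deriv (\<eta> X) f \<Longrightarrow> Mon f p \<in> \<rho> X"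
    and "tau_deriv (synth \<phi> \<eta>) f"
  shows "Mon f p \<in> sem (mon_lts T) \<phi> \<rho>"
  using assms
proof (induction "shml_depth \<phi>" arbitrary: \<phi> \<eta> \<rho> f p rule: less_induct)
  case less
  from less.prems(1) show ?case
  proof cases
    case 1
    then show ?thesis by simp
  next
    case 2
    with less.prems(2) show ?thesis by simp
  next
    case 4
    then show ?thesis using less.prems(5,6) by simp
  next
    case (5 \<psi> X)
    let ?E = "synth \<phi> \<eta>"
    let ?S = "{Mon f p |f p. tau_deriv ?E f} :: ('s, 'k, 'v) mstate set"
    have E: "trn_closed ?E" using trn_closed_synth less.prems(1,3,4) by blast
    have equiv: "step_equiv (synth \<psi> (\<eta>(X := ?E))) ?E"
      using trn_unfold_MaxFix[OF less.prems(4), of \<psi> X] 5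
      by (auto simp: step_equiv_def trn_step_TRec_iff fun_eq_iff)
    have "?S \<subseteq> sem (mon_lts T) \<psi> (\<rho>(X := ?S))"
    proof
      fix r assume "r \<in> ?S"
      then obtain g q where r: "r = Mon g q" and g: "tau_deriv ?E g" by blast
      have "Mon g q \<in> sem (mon_lts T) \<psi> (\<rho>(X := ?S))"
      proof (rule less.hyps)
        \<comment> \<open>The body differs from \<open>FF\<close> because the normal form requires
          \<open>X\<close> to be free in it.\<close>
        show "shml_depth \<psi> < shml_depth \<phi>" "shml_nf \<psi>" "\<psi> \<noteq> FF" "shml_dfv \<psi> = {}"
          using 5 less.prems(3) by auto
        show "closed_env (\<eta>(X := ?E))" using E less.prems(4) by (rule closed_env_upd[rotated])
        show "tau_deriv (synth \<psi> (\<eta>(X := ?E))) g"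
          using g tau_deriv_step_equiv[OF equiv] by blast
        show "Mon h s \<in> (\<rho>(X := ?S)) Y"
          if "Y \<in> shml_lfv \<psi>" "tau_deriv ((\<eta>(X := ?E)) Y) h" for Y h s
          using that less.prems(5) 5(1) by (auto split: if_splits)
      qed
      with r show "r \<in> sem (mon_lts T) \<psi> (\<rho>(X := ?S))" by simp
    qed
    then have "?S \<subseteq> sem (mon_lts T) \<phi> \<rho>" using 5(1) by auto
    then show ?thesis using less.prems(6) by blast
  next
    case (3 bs)
    then obtain \<phi>s where \<phi>: "\<phi> = Conj \<phi>s" by blast
    let ?E = "synth \<phi> \<eta>"
    note E_step = trn_step_Conj_iff[OF less.prems(1)[unfolded \<phi>] less.prems(3)[unfolded \<phi>]
        less.prems(4), folded \<phi>]
    \<comment> \<open>All silent steps of a conjunction's transducer are suppressions, which lead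
      back to it. Silent moves before the visible action thus cost no protection.\<close>
    have E_deriv: "step_equiv g ?E" if "tau_deriv ?E g" for g
      using that
    proof induction
      case (step g \<gamma> g')
      then have "trn_step ?E \<gamma> Tau g'" by (simp add: step_equiv_def)
      then have "g' = ?E" unfolding E_step by (auto split: if_splits)
      then show ?case by (simp add: step_equiv_def)
    qed
    have "Mon f p \<in> sem (mon_lts T) (Nec \<pi> c \<psi>) \<rho>" if mem: "Nec \<pi> c \<psi> \<in> set \<phi>s" for \<pi> c \<psi>
    proof -
      have nf\<psi>: "shml_nf \<psi>" using shml_nf_ConjE less.prems(1) \<phi> mem by blast
      have "r \<in> sem (mon_lts T) (shml_subst \<psi> \<sigma>) \<rho>"
        if w: "weak (mon_lts T) (Mon f p) \<alpha> r" and m: "mtch \<pi> \<alpha> = Some \<sigma>"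
          and c: "cond_subst c \<sigma> \<Down> True" for \<alpha> r \<sigma>
      proof -
        have den: "\<alpha> \<in> sym_den \<pi> c" using m c by (auto simp: sym_den_def)
        obtain r1 r2 where r1: "(\<lambda>r r'. mon_lts T r Tau r')\<^sup>*\<^sup>* (Mon f p) r1"
          and r2: "mon_lts T r1 (Obs \<alpha>) r2" and r: "(\<lambda>r r'. mon_lts T r Tau r')\<^sup>*\<^sup>* r2 r"
          using w unfolding weak_def by blast
        obtain g q where g: "r1 = Mon g q" "step_equiv g ?E"
          using mon_lts_taus[OF r1 less.prems(6)] E_deriv by blast
        \<comment> \<open>Disjointness is used here: the branch that let \<open>\<alpha>\<close>
          through must be the branch of \<open>\<psi>\<close>, so \<open>\<psi>\<close> cannot be
          \<open>FF\<close>. The default rule is blocked because that branch already reacts to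
          \<open>\<alpha>\<close>.\<close>
        have "\<psi> \<noteq> FF \<and> (\<exists>q'. r2 = Mon (synth (shml_subst \<psi> \<sigma>) \<eta>) q')"
          using r2[unfolded g]
        proof cases
          case (iTrn \<alpha>' p' e')
          from iTrn(3) g have "trn_step ?E (In \<alpha>') (Obs \<alpha>) e'" by (simp add: step_equiv_def)
          then obtain \<pi>' c' \<psi>' \<sigma>' where *: "Nec \<pi>' c' \<psi>' \<in> set \<phi>s" "mtch \<pi>' \<alpha>' = Some \<sigma>'"
            "cond_subst c' \<sigma>' \<Down> True" "\<psi>' \<noteq> FF" "\<alpha> = \<alpha>'" "e' = synth (shml_subst \<psi>' \<sigma>') \<eta>"
            unfolding E_step by (auto split: if_splits)
          then have "\<alpha> \<in> sym_den \<pi>' c'" by (auto simp: sym_den_def)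
          then have "\<pi> = \<pi>' \<and> c = c' \<and> \<psi> = \<psi>'"
            using shml_nf_Conj_unique less.prems(1) \<phi> mem *(1) den by blast
          with * m iTrn show ?thesis by auto
        next
          case (iIns e')
          from iIns g have "trn_step ?E Ins (Obs \<alpha>) e'" by (simp add: step_equiv_def)
          then show ?thesis unfolding E_step by auto
        next
          case (iTer p')
          have "\<exists>\<mu> e'. trn_step ?E (In \<alpha>) \<mu> e'"
            unfolding E_step using mem m c by (cases "\<psi> = FF") fastforce+
          with iTer g show ?thesis by (auto simp: step_equiv_def)
        qed
        then obtain q' where \<psi>: "\<psi> \<noteq> FF" and r2: "r2 = Mon (synth (shml_subst \<psi> \<sigma>) \<eta>) q'"
          by blast
        obtain h s where h: "r = Mon h s" "tau_deriv (synth (shml_subst \<psi> \<sigma>) \<eta>) h"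
          using mon_lts_taus[OF r[unfolded r2] tau_deriv_self] by blast
        have "Mon h s \<in> sem (mon_lts T) (shml_subst \<psi> \<sigma>) \<rho>"
        proof (rule less.hyps[OF _ _ _ _ less.prems(4) _ h(2)])
          have "shml_depth (Nec \<pi> c \<psi>) \<le> sum_list (map shml_depth \<phi>s)"
            using imageI[OF mem, of shml_depth] by (intro member_le_sum_list) simp_all
          then show "shml_depth (shml_subst \<psi> \<sigma>) < shml_depth \<phi>" using \<phi> by simp
          show "shml_nf (shml_subst \<psi> \<sigma>)" using nf\<psi> by (rule shml_nf_subst)
          show "shml_subst \<psi> \<sigma> \<noteq> FF" using \<psi> by simp
          have "dom \<sigma> = pat_bv \<pi>" using m by (simp add: mtch_Some_iff matches_def)
          moreover have "shml_dfv \<psi> \<subseteq> pat_bv \<pi>"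
            using less.prems(3) \<phi> mem by fastforce
          ultimately show "shml_dfv (shml_subst \<psi> \<sigma>) = {}" using shml_dfv_subst[of \<psi> \<sigma>] by blast
          show "Mon k t \<in> \<rho> Y" if "Y \<in> shml_lfv (shml_subst \<psi> \<sigma>)" "tau_deriv (\<eta> Y) k" for Y k t
          proof (rule less.prems(5)[OF _ that(2)])
            show "Y \<in> shml_lfv \<phi>" using that(1) UN_upper[OF mem, of shml_lfv] \<phi> by auto
          qed
        qed
        with h show ?thesis by simp
      qed
      then show ?thesis by auto
    qed
    then have "Mon f p \<in> sem (mon_lts T) \<psi> \<rho>" if "\<psi> \<in> set \<phi>s" for \<psi>
      using that shml_nf_ConjE less.prems(1) \<phi> by metis
    then show ?thesis using \<phi> by simp
  qed
qed


section \<open>Transparency\<close>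

text \<open>An environment built by successive unfoldings of maximal fixed points; each of them carries a
  post-fixed point as witness. Unbound variables are interpreted by the harmless \<^const>\<open>TId\<close>.\<close>

inductive fix_env ::
  "('s, ('k, 'v) act) lts \<Rightarrow> (lvar \<Rightarrow> ('k, 'v) trn) \<Rightarrow> (lvar \<Rightarrow> 's set) \<Rightarrow> bool" for T where
  base: "fix_env T (\<lambda>X. TId) \<rho>"
| upd: "fix_env T \<eta> \<rho> \<Longrightarrow> shml_nf (MaxFix X \<phi>) \<Longrightarrow> shml_dfv \<phi> = {} \<Longrightarrow>
    S \<subseteq> sem T \<phi> (\<rho>(X := S)) \<Longrightarrow>
    fix_env T (\<eta>(X := synth (MaxFix X \<phi>) \<eta>)) (\<rho>(X := S))"

lemma fix_env_closed: "fix_env T \<eta> \<rho> \<Longrightarrow> closed_env \<eta>"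
proof (induction rule: fix_env.induct)
  case (base \<rho>)
  then show ?case by (simp add: closed_env_def trn_closed_def)
next
  case (upd \<eta> \<rho> X \<phi> S)
  then show ?case
    by (intro closed_env_upd trn_closed_synth) auto
qed

text \<open>The environments \<open>\<eta>'\<close> and \<open>\<rho>'\<close> are those in force
  when \<open>X\<close> was bound. A variable thereby reduces to the fixed point that introduced
  it.\<close>

lemma fix_env_lookup:
  assumes "fix_env T \<eta> \<rho>"
  shows "\<eta> X = TId \<or> (\<exists>\<phi> \<eta>' \<rho>'. fix_env T \<eta>' \<rho>' \<and> shml_nf (MaxFix X \<phi>) \<and> shml_dfv \<phi> = {} \<and>
    \<eta> X = synth (MaxFix X \<phi>) \<eta>' \<and> \<rho> X \<subseteq> sem T (MaxFix X \<phi>) \<rho>')"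
  using assms
proof induction
  case (upd \<eta> \<rho> Y \<phi> S)
  show ?case
  proof (cases "X = Y")
    case True
    have "S \<subseteq> sem T (MaxFix X \<phi>) \<rho>" using upd True by auto
    with True upd show ?thesis by (metis fun_upd_same)
  next
    case False
    with upd show ?thesis by simp
  qed
qed simp

text \<open>Taking a silent predecessor \<open>p\<close> of the current state makes the relation closed under silent moves
  of the system by construction.\<close>

definition transparent :: "('s, ('k, 'v) act) lts \<Rightarrow> ('k, 'v) trn \<Rightarrow> 's \<Rightarrow> bool" where
  "transparent T e q \<longleftrightarrow> (\<exists>p \<phi> \<eta> \<rho>. (\<lambda>r r'. T r Tau r')\<^sup>*\<^sup>* p q \<and> p \<in> sem T \<phi> \<rho> \<and> e = synth \<phi> \<eta> \<and>
     fix_env T \<eta> \<rho> \<and> shml_nf \<phi> \<and> shml_dfv \<phi> = {})"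

lemma transparent_TId: "transparent T TId q"
  unfolding transparent_def
  by (rule exI[of _ q], rule exI[of _ TT]) (auto intro: fix_env.base shml_nf.intros)

lemma transparentI:
  "(\<lambda>r r'. T r Tau r')\<^sup>*\<^sup>* p q \<Longrightarrow> p \<in> sem T \<phi> \<rho> \<Longrightarrow> fix_env T \<eta> \<rho> \<Longrightarrow> shml_nf \<phi> \<Longrightarrow> shml_dfv \<phi> = {} \<Longrightarrow>
    transparent T (synth \<phi> \<eta>) q"
  unfolding transparent_def by blast

lemma transparent_tau: "transparent T e q \<Longrightarrow> T q Tau q' \<Longrightarrow> transparent T e q'"
  unfolding transparent_def by (metis rtranclp.rtrancl_into_rtrancl)

text \<open>Prefixes and sums arise only inside the recursion of a conjunction, never at the top of
  the transducer of a normal form. This disposes of \<open>ePre\<close> and \<open>eSum\<close> in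
  the induction on transitions.\<close>

lemma transparent_shape:
  assumes "transparent T e q"
  obtains "e = TId" | x f where "e = TRec x f"
proof -
  obtain \<phi> \<eta> \<rho> where e: "e = synth \<phi> \<eta>" and env: "fix_env T \<eta> \<rho>" and nf: "shml_nf \<phi>"
    using assms unfolding transparent_def by blast
  from nf show thesis
  proof cases
    case (4 X)
    with e fix_env_lookup[OF env, of X] show thesis using that by auto
  qed (use e that in auto)
qed

text \<open>Fixed points may be unguarded, so the induction is on the derivation of the transition, which
  gets shorter with each unfolding.\<close>

lemma transparent_step:
  assumes "trn_step e \<gamma> \<mu> e'" and "transparent T e q"
  shows "\<exists>\<alpha>. \<gamma> = In \<alpha> \<and> (\<forall>q'. T q (Obs \<alpha>) q' \<longrightarrow> \<mu> = Obs \<alpha> \<and> transparent T e' q')"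
  using assms
proof (induction arbitrary: q rule: trn_step.induct)
  case (eId \<alpha>)
  show ?case by (simp add: transparent_TId)
next
  case (ePre \<pi> \<gamma> \<sigma> c \<mu> \<pi>' e)
  show ?case by (rule transparent_shape[OF ePre.prems]) simp_all
next
  case (eSum e es \<gamma> \<mu> e')
  show ?case by (rule transparent_shape[OF eSum.prems]) simp_all
next
  case (eRec e x \<gamma> \<mu> e')
  obtain p \<phi> \<eta> \<rho> where pq: "(\<lambda>r r'. T r Tau r')\<^sup>*\<^sup>* p q" and p: "p \<in> sem T \<phi> \<rho>"
    and e: "TRec x e = synth \<phi> \<eta>" and env: "fix_env T \<eta> \<rho>" and nf: "shml_nf \<phi>" "shml_dfv \<phi> = {}"
    using eRec.prems unfolding transparent_def by blast
  \<comment> \<open>Isolated because the variable case reduces to it. Membership of \<open>p\<close>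
    in the fixed point yields a post-fixed point \<open>S\<close> containing \<open>p\<close>, which
    becomes the value of \<open>X\<close> in \<open>\<rho>\<close> while the unfolded recursion
    becomes its value in \<open>\<eta>\<close>.\<close>
  have max: ?case if p: "p \<in> sem T (MaxFix X \<psi>) \<rho>" and e: "TRec x e = synth (MaxFix X \<psi>) \<eta>"
    and env: "fix_env T \<eta> \<rho>" and nf: "shml_nf (MaxFix X \<psi>)" "shml_dfv \<psi> = {}" for X \<psi> \<eta> \<rho>
  proof (rule eRec.IH)
    obtain S where pS: "p \<in> S" and S: "S \<subseteq> sem T \<psi> (\<rho>(X := S))"
      using p unfolding sem.simps by blast
    have x: "x = Suc X" and body: "e = synth \<psi> (\<eta>(X := TVar (Suc X)))"
      using e by (simp_all only: synth.simps trn.inject)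
    have "trn_unfold e x (TRec x e) = synth \<psi> (\<eta>(X := synth (MaxFix X \<psi>) \<eta>))"
      unfolding e unfolding x body by (rule trn_unfold_MaxFix[OF fix_env_closed[OF env]])
    moreover have "transparent T (synth \<psi> (\<eta>(X := synth (MaxFix X \<psi>) \<eta>))) q"
    proof (rule transparentI[of T p q, OF pq])
      show "p \<in> sem T \<psi> (\<rho>(X := S))" using pS S by (rule rev_subsetD)
      show "fix_env T (\<eta>(X := synth (MaxFix X \<psi>) \<eta>)) (\<rho>(X := S))"
        using env nf S by (rule fix_env.upd)
      show "shml_nf \<psi>" using nf(1) by cases auto
    qed (rule nf(2))
    ultimately show "transparent T (trn_unfold e x (TRec x e)) q" by (simp only:)
  qed
  from nf(1) show ?case
  proof cases
    case (4 X)
    then have "\<eta> X = TRec x e" "p \<in> \<rho> X" using e p by auto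
    from fix_env_lookup[OF env, of X] show ?thesis
    proof (elim disjE exE conjE)
      assume "\<eta> X = TId"
      with \<open>\<eta> X = TRec x e\<close> show ?thesis by simp
    next
      fix \<psi> \<eta>' \<rho>' assume "fix_env T \<eta>' \<rho>'" "shml_nf (MaxFix X \<psi>)" "shml_dfv \<psi> = {}"
        "\<eta> X = synth (MaxFix X \<psi>) \<eta>'" "\<rho> X \<subseteq> sem T (MaxFix X \<psi>) \<rho>'"
      moreover from this(5) \<open>p \<in> \<rho> X\<close> have "p \<in> sem T (MaxFix X \<psi>) \<rho>'" by (rule subsetD)
      ultimately show ?thesis using \<open>\<eta> X = TRec x e\<close> by (intro max[of X \<psi> \<rho>' \<eta>']) (simp_all only:)
    qed
  next
    case (5 \<psi> X)
    show ?thesis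
      by (rule max[OF p[unfolded 5] e[unfolded 5] env nf(1)[unfolded 5]]) (use nf(2) 5 in simp)
  next
    case (3 bs)
    then obtain \<phi>s where \<phi>: "\<phi> = Conj \<phi>s" by blast
    have "trn_step (synth (Conj \<phi>s) \<eta>) \<gamma> \<mu> e'" using trn_step.eRec[OF eRec.hyps] e \<phi> by simp
    then obtain \<pi> c \<psi> \<alpha> \<sigma> where *: "Nec \<pi> c \<psi> \<in> set \<phi>s" "\<gamma> = In \<alpha>" "mtch \<pi> \<alpha> = Some \<sigma>"
      "cond_subst c \<sigma> \<Down> True"
      "if \<psi> = FF then \<mu> = Tau \<and> e' = synth (Conj \<phi>s) \<eta>
       else \<mu> = Obs \<alpha> \<and> e' = synth (shml_subst \<psi> \<sigma>) \<eta>"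
      using trn_step_Conj_iff[OF nf[unfolded \<phi>] fix_env_closed[OF env]] by blast
    have "\<mu> = Obs \<alpha> \<and> transparent T e' q'" if q': "T q (Obs \<alpha>) q'" for q'
    proof -
      \<comment> \<open>The silent path from \<open>p\<close> to \<open>q\<close> is absorbed into
        the weak transition, so the necessity that holds at \<open>p\<close> constrains
        \<open>q'\<close>.\<close>
      have "weak T p \<alpha> q'" unfolding weak_def using pq q' by blast
      moreover have "p \<in> sem T (Nec \<pi> c \<psi>) \<rho>" using p \<phi> *(1) by auto
      ultimately have q'_sem: "q' \<in> sem T (shml_subst \<psi> \<sigma>) \<rho>" using *(3,4) by auto
      then have "\<psi> \<noteq> FF" by auto
      moreover have "shml_nf (shml_subst \<psi> \<sigma>)"
        using shml_nf_ConjE nf(1) \<phi> *(1) shml_nf_subst by blast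
      moreover have "shml_dfv (shml_subst \<psi> \<sigma>) = {}"
      proof -
        have "dom \<sigma> = pat_bv \<pi>" using *(3) by (simp add: mtch_Some_iff matches_def)
        moreover have "shml_dfv \<psi> \<subseteq> pat_bv \<pi>" using nf(2) \<phi> *(1) by fastforce
        ultimately show ?thesis using shml_dfv_subst[of \<psi> \<sigma>] by blast
      qed
      ultimately show ?thesis using transparentI[of T q' q', OF rtranclp.rtrancl_refl q'_sem env] *(5)
        by simp
    qed
    with *(2) show ?thesis by blast
  qed (use e in simp_all)
qed

section \<open>From transparency to bisimilarity\<close>

lemma transparent_no_Ins: "transparent T e q \<Longrightarrow> \<not> trn_step e Ins \<mu> e'"
  by (rule notI) (drule (1) transparent_step, simp)

lemma transparent_Obs:
  assumes "transparent T e q" and "trn_step e (In \<alpha>) \<mu> e'" and "T q (Obs \<alpha>) q'"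
  shows "\<mu> = Obs \<alpha>" and "transparent T e' q'"
  using transparent_step[OF assms(2,1)] assms(3) by simp_all

text \<open>The relation pairs a monitored system with its own bare state;
  \<open>transparent\<close> is the invariant that keeps the two in lockstep.\<close>

lemma transparent_bisimilar:
  fixes T :: "('s, ('k, 'v) act) lts"
  assumes "transparent T e p"
  shows "bisimilar (mon_lts T) (Mon e p) (Sys p)"
proof -
  let ?R = "\<lambda>(r :: ('s, 'k, 'v) mstate) (s :: ('s, 'k, 'v) mstate).
    \<exists>e p. r = Mon e p \<and> s = Sys p \<and> transparent T e p"
  have "bisimulation (mon_lts T) ?R"
    unfolding bisimulation_def
  proof (intro allI impI conjI)
    fix r s \<mu> r' assume "?R r s" and step: "mon_lts T r \<mu> r'"
    then obtain e p where r: "r = Mon e p" "s = Sys p" and tr: "transparent T e p" by blast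
    have "\<exists>e' p'. r' = Mon e' p' \<and> T p \<mu> p' \<and> transparent T e' p'"
      using step unfolding r(1)
    proof cases
      case (iTrn \<alpha> p' e')
      with transparent_Obs[of T e p, OF tr iTrn(3,2)] show ?thesis by simp
    next
      case (iAsy p')
      with transparent_tau[of T e p, OF tr iAsy(3)] show ?thesis by simp
    next
      case (iIns e')
      with transparent_no_Ins[of T e p, OF tr] show ?thesis by simp
    next
      case (iTer \<alpha> p')
      with transparent_TId[of T p'] show ?thesis by simp
    qed
    then obtain e' p' where "r' = Mon e' p'" and p': "T p \<mu> p'" and "transparent T e' p'" by blast
    moreover have "mon_lts T s \<mu> (Sys p')" unfolding r(2) using p' by (rule mon_lts.sys)
    ultimately show "\<exists>s'. mon_lts T s \<mu> s' \<and> ?R r' s'" by blast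
  next
    fix r s \<mu> s' assume "?R r s" and step: "mon_lts T s \<mu> s'"
    then obtain e p where r: "r = Mon e p" "s = Sys p" and tr: "transparent T e p" by blast
    obtain p' where s': "s' = Sys p'" and p': "T p \<mu> p'"
      using step unfolding r(2) by cases simp
    have "\<exists>e'. mon_lts T (Mon e p) \<mu> (Mon e' p') \<and> transparent T e' p'"
    proof (cases \<mu>)
      case Tau
      from p'[unfolded Tau] have "mon_lts T (Mon e p) Tau (Mon e p')" by (rule mon_lts.iAsy)
      moreover from tr p'[unfolded Tau] have "transparent T e p'" by (rule transparent_tau)
      ultimately show ?thesis using Tau by blast
    next
      case (Obs \<alpha>)
      note p'_Obs = p'[unfolded Obs]
      show ?thesis
      \<comment> \<open>If the transducer reacts to \<open>\<alpha>\<close> at all, its output is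
        forced to be \<open>\<alpha>\<close>, since the system really performs it. Otherwise
        \<open>iTer\<close> applies, as nothing can be inserted, and continues with
        \<open>TId\<close>, which is transparent at every state.\<close>
      proof (cases "\<exists>\<nu> e'. trn_step e (In \<alpha>) \<nu> e'")
        case True
        then obtain \<nu> e' where e': "trn_step e (In \<alpha>) \<nu> e'" by blast
        note \<nu> = transparent_Obs[of T e p, OF tr e' p'_Obs]
        from p'_Obs e'[unfolded \<nu>(1)] have "mon_lts T (Mon e p) (Obs \<alpha>) (Mon e' p')"
          by (rule mon_lts.iTrn)
        with \<nu>(2) Obs show ?thesis by blast
      next
        case False
        moreover have "\<nexists>\<nu> e'. trn_step e Ins \<nu> e'"
          using transparent_no_Ins[of T e p, OF tr] by simp
        ultimately have "mon_lts T (Mon e p) (Obs \<alpha>) (Mon TId p')"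
          by (rule mon_lts.iTer[of T, OF p'_Obs])
        with transparent_TId[of T p'] Obs show ?thesis by blast
      qed
    qed
    with r(1) s' show "\<exists>r'. mon_lts T r \<mu> r' \<and> ?R r' s'" by blast
  qed
  with assms show ?thesis unfolding bisimilar_def by blast
qed

theorem mainTheorem1:
  fixes T :: "('s, ('k, 'v) act) lts"
    and \<phi> :: "('k, 'v) shml"
  assumes "shml_nf \<phi>" and "shml_closed \<phi>"
  shows "\<exists>e. trn_closed e \<and> enforces T e \<phi>"
proof (intro exI conjI)
  let ?\<eta> = "\<lambda>X. TId :: ('k, 'v) trn"
  have env: "closed_env ?\<eta>" by (simp add: closed_env_def trn_closed_def)
  have closed: "shml_lfv \<phi> = {}" "shml_dfv \<phi> = {}" using assms(2) by (auto simp: shml_closed_def)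
  show "trn_closed (synth \<phi> ?\<eta>)" using trn_closed_synth[OF assms(1) closed(2) env] .
  show "enforces T (synth \<phi> ?\<eta>) \<phi>"
    unfolding enforces_def
  proof (intro conjI allI impI)
    fix p assume "satisfiable T \<phi>"
    \<comment> \<open>Satisfiability enters through this exclusion alone.\<close>
    then have "\<phi> \<noteq> FF" by (auto simp: satisfiable_def csem_def)
    then show "Mon (synth \<phi> ?\<eta>) p \<in> csem (mon_lts T) \<phi>"
      unfolding csem_def using assms(1) closed env by (intro synth_sound[where \<eta> = ?\<eta>]) auto
  next
    fix p assume "p \<in> csem T \<phi>"
    then show "bisimilar (mon_lts T) (Mon (synth \<phi> ?\<eta>) p) (Sys p)"
      unfolding csem_def
      by (intro transparent_bisimilar transparentI[of T p p, OF rtranclp.rtrancl_refl] fix_env.base) (use assms(1) closed in auto)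
  qed
qed

end
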